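(* For every integer $n\ge 0$: (i) $\overline{R}_8^{\ast}(4n+3)\equiv 0\pmod 8$; (ii) $\overline{R}_8^{\ast}(8n+2\xi+1)\equiv 0\pmod 8$ for each $\xi\in\{1,2,3\}$.
   Context: An overpartition of a nonnegative integer $n$ is a partition of $n$ in which the first occurrence of each part size may be overlined. For a positive integer $\ell$, $\overline{R}_\ell^{\ast}(n)$ denotes the number of overpartitions of $n$ in which the non-overlined parts are $\ell$-regular, i.e. no non-overlined part is divisible by $\ell$ (overlined parts are unrestricted). With $f_h:=\prod_{m\ge 1}(1-q^{hm})$, the generating function is $\sum_{n\ge 0}\overline{R}_\ell^{\ast}(n)q^n=\frac{f_2f_\ell}{f_1^2}$. *)

theory Defs
  imports "HOL-Library.Multiset" "HOL-Number_Theory.Cong"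
begin

definition is_partition :: "nat multiset \<Rightarrow> nat \<Rightarrow> bool" where
  "is_partition M n \<longleftrightarrow> (\<forall>p \<in># M. 0 < p) \<and> sum_mset M = n"

(* An overpartition is a pair (M, S): M is the multiset of all its parts, and S is the
   set of those part sizes whose first occurrence is overlined. *)
definition overpartitions :: "nat \<Rightarrow> (nat multiset \<times> nat set) set" where
  "overpartitions n = {(M, S). is_partition M n \<and> S \<subseteq> set_mset M}"

(* One copy of each size in S is overlined, so exactly one copy is removed. *)
definition non_overlined_parts :: "nat multiset \<times> nat set \<Rightarrow> nat multiset" where
  "non_overlined_parts = (\<lambda>(M, S). M - mset_set S)"

definition Rstar :: "nat \<Rightarrow> nat \<Rightarrow> nat" where
  "Rstar l n = card {P \<in> overpartitions n. \<forall>p \<in># non_overlined_parts P. \<not> l dvd p}"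

(* Hence the cardinality in Rstar is that of a finite set. *)
lemma finite_overpartitions: "finite (overpartitions n)"
proof -
  let ?L = "{xs. set xs \<subseteq> {..n} \<and> length xs \<le> n}"
  have size_le: "size M \<le> sum_mset M" if "\<forall>p \<in># M. 0 < p" for M :: "nat multiset"
    using that by (induction M) auto
  have "M \<in> mset ` ?L" if "is_partition M n" for M
  proof -
    obtain xs where xs: "mset xs = M" using ex_mset by blast
    have "p \<le> n" if "p \<in># M" for p
      using \<open>is_partition M n\<close> that sum_mset.remove[of p M]
      by (simp add: is_partition_def)
    moreover have "size M \<le> n"
      using size_le[of M] that by (auto simp: is_partition_def)
    ultimately have "xs \<in> ?L" using xs by auto
    with xs show ?thesis by blast
  qed
  then have "{M. is_partition M n} \<subseteq> mset ` ?L" by blast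
  then have "finite {M. is_partition M n}"
    using finite_lists_length_le[of "{..n}" n] by (meson finite_atMost finite_imageI finite_subset)
  then have "finite (SIGMA M : {M. is_partition M n}. Pow (set_mset M))" by auto
  moreover have "overpartitions n = (SIGMA M : {M. is_partition M n}. Pow (set_mset M))"
    by (auto simp: overpartitions_def)
  ultimately show ?thesis by simp
qed

end

theory Submission
  imports Defs "HOL-Library.Disjoint_Sets" "HOL-Library.Z2"
begin

text \<open>
  The generating function of \<^const>\<open>Rstar\<close> \<open>l\<close> is that of all overpartitions multiplied by
  \<open>\<Prod>\<^sub>m (1 - q ^ (l * m))\<close>, a series in \<open>q ^ l\<close>. A divisibility that holds for the number of
  overpartitions on a whole residue class modulo \<open>l\<close> therefore passes to \<^const>\<open>Rstar\<close> \<open>l\<close> on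
  the same class (\<open>dvd_Rstar_if_dvd_overpartitions\<close>). The combinatorial form of this is to detach
  from an overpartition its non-overlined multiples of \<open>l\<close>, whose total is a multiple of \<open>l\<close>.

  The exponents in the theorem are the numbers congruent to 3, 5 or 7 modulo 8, that is, the odd
  numbers in residue classes modulo 8 that contain no square. So it suffices that 8 divides the
  number of overpartitions of every odd non-square \<open>n\<close> (\<open>eight_dvd_card_overpartitions\<close>).

  A partition with \<open>k\<close> distinct part sizes carries \<open>2 ^ k\<close> overpartitions, so modulo 8 only
  \<open>k = 1\<close> and \<open>k = 2\<close> count. Partitions with one part size correspond to divisors of \<open>n\<close>;
  since \<open>n\<close> is not a square, there are \<open>2 * L\<close> of these, where \<open>L\<close> is the number of divisors below
  the square root. Conjugation
  of Ferrers diagrams preserves the number of part sizes, and its fixed points among the partitions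
  of \<open>n\<close> with two part sizes correspond, for odd \<open>n\<close>, to the divisors of \<open>n\<close> below the square root
  (\<open>card_self_conjugate\<close>). Hence the number of partitions with two sizes has the form
  \<open>L + 2 * k\<close>, and the number of overpartitions is congruent to
  \<open>2 * (2 * L) + 4 * (L + 2 * k) = 8 * (L + k)\<close>.
\<close>

section \<open>Overpartitions modulo 8\<close>

text \<open>In the two-element field each orbit contributes \<open>1 + 1 = 0\<close> to the sum of 1 over \<open>A\<close>.\<close>

lemma even_card_involution:
  assumes "\<And>x. x \<in> A \<Longrightarrow> f x \<in> A" "\<And>x. x \<in> A \<Longrightarrow> f (f x) = x" "\<And>x. x \<in> A \<Longrightarrow> f x \<noteq> x"
  shows "even (card A)"
proof -
  have "(\<Sum>x\<in>A. (1 :: bit)) = 0"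
    using assms by (intro sum_involution_eq_0[where h = f]) auto
  then have "even (of_nat (card A) :: bit)"
    by simp
  then show ?thesis
    by (simp only: even_of_nat_iff)
qed

lemma finite_partitions: "finite {M. is_partition M n}"
proof -
  have "{M. is_partition M n} \<subseteq> fst ` overpartitions n"
    by (force simp: overpartitions_def)
  then show ?thesis
    using finite_overpartitions finite_surj by blast
qed

lemma card_overpartitions:
  "card (overpartitions n) = (\<Sum>M | is_partition M n. 2 ^ card (set_mset M))"
proof -
  have "overpartitions n = (SIGMA M : {M. is_partition M n}. Pow (set_mset M))"
    by (auto simp: overpartitions_def)
  then show ?thesis
    by (simp add: card_SigmaI finite_partitions card_Pow)
qed

text \<open>The weight \<open>2 ^ k\<close> of a partition vanishes modulo 8 as soon as it has \<open>k \<ge> 3\<close> part sizes.\<close>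

lemma card_overpartitions_cong:
  assumes "0 < n"
  shows "[card (overpartitions n) =
    2 * card {M. is_partition M n \<and> card (set_mset M) = 1} +
    4 * card {M. is_partition M n \<and> card (set_mset M) = 2}] (mod 8)"
proof -
  let ?P = "{M. is_partition M n}"
  let ?w = "\<lambda>M :: nat multiset. (2 :: nat) ^ card (set_mset M)"
  let ?v = "\<lambda>M :: nat multiset. (if card (set_mset M) = 1 then 2 else 0) +
      (if card (set_mset M) = 2 then 4 else 0 :: nat)"
  have "[?w M = ?v M] (mod 8)" if "M \<in> ?P" for M
  proof -
    have "M \<noteq> {#}" using that assms by (auto simp: is_partition_def)
    then have "card (set_mset M) \<noteq> 0" by simp
    moreover have "[?w M = 0] (mod 8)" if big: "3 \<le> card (set_mset M)"
      using le_imp_power_dvd[OF big, of "2 :: nat"] by (simp add: cong_0_iff)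
    ultimately consider "card (set_mset M) = 1" | "card (set_mset M) = 2"
      | "3 \<le> card (set_mset M)" "[?w M = 0] (mod 8)"
      by linarith
    then show ?thesis
      by cases auto
  qed
  then have "[(\<Sum>M\<in>?P. ?w M) = (\<Sum>M\<in>?P. ?v M)] (mod 8)"
    by (intro cong_sum)
  also have "(\<Sum>M\<in>?P. ?v M) =
      2 * card {M \<in> ?P. card (set_mset M) = 1} + 4 * card {M \<in> ?P. card (set_mset M) = 2}"
    by (simp add: sum.distrib finite_partitions flip: sum.inter_filter)
  finally show ?thesis
    by (simp add: card_overpartitions)
qed

section \<open>Partitions with one or two part sizes\<close>

lemma card_one_size_partitions:
  assumes "0 < n"
  shows "card {M. is_partition M n \<and> card (set_mset M) = 1} = card {a. a dvd n}"
proof -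
  have "bij_betw (\<lambda>a. replicate_mset (n div a) a) {a. a dvd n}
      {M. is_partition M n \<and> card (set_mset M) = 1}"
  proof (rule bij_betwI[where g = "\<lambda>M. the_elem (set_mset M)"])
    show "(\<lambda>a. replicate_mset (n div a) a) \<in> {a. a dvd n} \<rightarrow>
      {M. is_partition M n \<and> card (set_mset M) = 1}"
      using assms by (auto simp: is_partition_def elim!: dvdE intro: Nat.gr0I)
  next
    have key: "\<exists>a. a dvd n \<and> M = replicate_mset (n div a) a \<and> set_mset M = {a}"
      if "is_partition M n" "card (set_mset M) = 1" for M
    proof -
      from that(2) obtain a where a: "set_mset M = {a}" by (auto simp: card_Suc_eq)
      then have M: "M = replicate_mset (size M) a"
        by (metis set_mset_subset_singletonD subset_refl)
      then have "sum_mset M = size M * a"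
        by (metis of_nat_id sum_mset_replicate_mset)
      then have n: "n = size M * a" and "0 < a"
        using that(1) a by (simp_all add: is_partition_def)
      then have "n div a = size M" and "a dvd n"
        by simp_all
      then show ?thesis
        using M a by metis
    qed
    show "(\<lambda>M. the_elem (set_mset M)) \<in>
      {M. is_partition M n \<and> card (set_mset M) = 1} \<rightarrow> {a. a dvd n}"
      using key by fastforce
    show "replicate_mset (n div the_elem (set_mset M)) (the_elem (set_mset M)) = M"
      if "M \<in> {M. is_partition M n \<and> card (set_mset M) = 1}" for M
      using key[of M] that by auto
    show "the_elem (set_mset (replicate_mset (n div a) a)) = a" if "a \<in> {a. a dvd n}" for a
      using that assms by (auto elim!: dvdE)
  qed
  then show ?thesis by (simp add: bij_betw_same_card)
qed

text \<open>
  A tuple \<open>(a, b, c, d)\<close> stands for the partition with \<open>b\<close> parts \<open>a\<close> and \<open>d\<close> parts \<open>c\<close>. Ordering the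
  sizes by \<open>a < c\<close> makes the tuple unique.
\<close>

definition two_size_data :: "nat \<Rightarrow> (nat \<times> nat \<times> nat \<times> nat) set" where
  "two_size_data n = {(a, b, c, d). 0 < a \<and> a < c \<and> 0 < b \<and> 0 < d \<and> a * b + c * d = n}"

lemma bij_betw_two_size_data:
  "bij_betw (\<lambda>(a, b, c, d). replicate_mset b a + replicate_mset d c) (two_size_data n)
    {M. is_partition M n \<and> card (set_mset M) = 2}"
  unfolding bij_betw_def
proof
  let ?f = "\<lambda>(a :: nat, b, c, d). replicate_mset b a + replicate_mset d c"
  show "inj_on ?f (two_size_data n)"
  proof (rule inj_onI)
    fix x y assume xy: "x \<in> two_size_data n" "y \<in> two_size_data n" "?f x = ?f y"
    obtain a b c d where x: "x = (a, b, c, d)" by (cases x)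
    obtain a' b' c' d' where y: "y = (a', b', c', d')" by (cases y)
    have 1: "(a, b, c, d) \<in> two_size_data n" and 2: "(a', b', c', d') \<in> two_size_data n"
      and eq: "replicate_mset b a + replicate_mset d c = replicate_mset b' a' + replicate_mset d' c'"
      using xy x y by auto
    from arg_cong[OF eq, of set_mset] have "{a, c} = {a', c'}"
      using 1 2 by (auto simp: two_size_data_def split: if_splits)
    then have [simp]: "a' = a" "c' = c"
      using 1 2 by (auto simp: two_size_data_def doubleton_eq_iff)
    show "x = y"
      unfolding x y
      using arg_cong[OF eq, of "\<lambda>M. count M a"] arg_cong[OF eq, of "\<lambda>M. count M c"] 1
      by (auto simp: two_size_data_def)
  qed
  show "?f ` two_size_data n = {M. is_partition M n \<and> card (set_mset M) = 2}"
  proof (intro set_eqI iffI; clarify?)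
    fix a b c d assume "(a, b, c, d) \<in> two_size_data n"
    then show "is_partition (replicate_mset b a + replicate_mset d c) n \<and>
        card (set_mset (replicate_mset b a + replicate_mset d c)) = 2"
      by (auto simp: two_size_data_def is_partition_def card_insert_if algebra_simps)
  next
    fix M assume M: "is_partition M n" "card (set_mset M) = 2"
    then obtain x y where "set_mset M = {x, y}" "x \<noteq> y"
      by (auto simp: card_2_iff)
    then obtain a c where ac: "set_mset M = {a, c}" "a < c"
      by (metis insert_commute nat_neq_iff)
    let ?b = "count M a" and ?d = "count M c"
    have M_eq: "M = replicate_mset ?b a + replicate_mset ?d c"
    proof (rule multiset_eqI)
      fix x show "count M x = count (replicate_mset ?b a + replicate_mset ?d c) x"
      proof -
        consider "x = a" | "x = c" | "x \<noteq> a" "x \<noteq> c" "x \<notin># M"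
          using ac(1) by blast
        then show ?thesis
          using ac(2) by cases (simp_all add: count_eq_zero_iff)
      qed
    qed
    have "sum_mset M = ?b * a + ?d * c"
      by (subst M_eq) simp
    then have "(a, ?b, c, ?d) \<in> two_size_data n"
      using M ac by (auto simp: two_size_data_def is_partition_def algebra_simps)
    then show "M \<in> ?f ` two_size_data n"
      using M_eq by force
  qed
qed

text \<open>
  The Ferrers diagram of such a partition has \<open>d\<close> rows of length \<open>c\<close> above \<open>b\<close> rows of length \<open>a\<close>.
  Read by columns, it has \<open>a\<close> columns of length \<open>b + d\<close> followed by \<open>c - a\<close> columns of length \<open>d\<close>.
\<close>

definition conjugate :: "nat \<times> nat \<times> nat \<times> nat \<Rightarrow> nat \<times> nat \<times> nat \<times> nat" where
  "conjugate = (\<lambda>(a, b, c, d). (d, c - a, b + d, a))"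

lemma conjugate_in_two_size_data:
  "x \<in> two_size_data n \<Longrightarrow> conjugate x \<in> two_size_data n"
proof (cases x)
  case (fields a b c d)
  assume x: "x \<in> two_size_data n"
  then obtain e where "c = a + e" "0 < e"
    using fields less_imp_add_positive by (auto simp: two_size_data_def)
  then show ?thesis
    using x fields by (auto simp: two_size_data_def conjugate_def algebra_simps)
qed

lemma conjugate_conjugate: "x \<in> two_size_data n \<Longrightarrow> conjugate (conjugate x) = x"
  by (auto simp: two_size_data_def conjugate_def)

text \<open>
  A self-conjugate tuple has the form \<open>(a, b, a + b, a)\<close> and describes the factorization
  \<open>n = a * (a + 2 * b)\<close>. Conversely, if \<open>n = a * e\<close> with \<open>a < e\<close> and \<open>n\<close> is odd, then both factors are
  odd, so that \<open>e - a\<close> is even and \<open>b = (e - a) / 2\<close> recovers the tuple.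
\<close>

lemma card_self_conjugate:
  assumes "odd n"
  shows "card {x \<in> two_size_data n. conjugate x = x} = card {a. a dvd n \<and> a * a < n}"
proof -
  have shape: "\<exists>a b. z = (a, b, a + b, a) \<and> 0 < a \<and> 0 < b \<and> n = a * (a + 2 * b)"
    if "z \<in> {x \<in> two_size_data n. conjugate x = x}" for z
  proof -
    obtain a b c d where z: "z = (a, b, c, d)" by (cases z)
    have "(d, c - a, b + d, a) = (a, b, c, d)"
      using that unfolding z conjugate_def by (simp only: mem_Collect_eq prod.case)
    then have cd: "d = a" "c = a + b"
      by (metis add.commute prod.inject)+
    have pos: "0 < a" "0 < b" and "a * b + c * d = n"
      using that unfolding z two_size_data_def by (simp_all only: mem_Collect_eq prod.case)
    then have "n = a * (a + 2 * b)"
      by (simp add: cd distrib_left distrib_right mult.commute)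
    with z cd pos show ?thesis by blast
  qed
  have "bij_betw fst {x \<in> two_size_data n. conjugate x = x} {a. a dvd n \<and> a * a < n}"
    unfolding bij_betw_def
  proof
    show "inj_on fst {x \<in> two_size_data n. conjugate x = x}"
    proof (rule inj_onI)
      fix x y
      assume xy: "x \<in> {x \<in> two_size_data n. conjugate x = x}"
        "y \<in> {x \<in> two_size_data n. conjugate x = x}" "fst x = fst y"
      obtain a b where "x = (a, b, a + b, a)" "0 < a" "n = a * (a + 2 * b)"
        using shape[OF xy(1)] by blast
      moreover obtain a' b' where "y = (a', b', a' + b', a')" "n = a' * (a' + 2 * b')"
        using shape[OF xy(2)] by blast
      ultimately show "x = y" using xy(3)
        by auto
    qed
    show "fst ` {x \<in> two_size_data n. conjugate x = x} = {a. a dvd n \<and> a * a < n}"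
    proof (intro set_eqI iffI; clarify?)
      fix x assume "x \<in> two_size_data n" "conjugate x = x"
      then obtain a b where "x = (a, b, a + b, a)" "0 < a" "0 < b" "n = a * (a + 2 * b)"
        using shape by blast
      then show "fst x dvd n \<and> fst x * fst x < n" by simp
    next
      fix a assume a: "a dvd n" "a * a < n"
      then obtain e where e: "n = a * e" by blast
      with a have "a < e" "0 < a" by (auto intro: Nat.gr0I)
      moreover have "even (e - a)" using assms e by (auto simp: \<open>a < e\<close> less_imp_le)
      then obtain b where "e - a = 2 * b" by blast
      ultimately have "e = a + 2 * b" "0 < b" by auto
      then have "(a, b, a + b, a) \<in> {x \<in> two_size_data n. conjugate x = x}"
        using e \<open>0 < a\<close>
        by (simp add: two_size_data_def conjugate_def distrib_left distrib_right mult.commute)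
      then show "a \<in> fst ` {x \<in> two_size_data n. conjugate x = x}" by force
    qed
  qed
  then show ?thesis by (rule bij_betw_same_card)
qed

text \<open>The complementary divisor exchanges the divisors below and above the square root.\<close>

lemma card_divisors_nonsquare:
  fixes n :: nat
  assumes "\<nexists>s. s * s = n"
  shows "card {a. a dvd n} = 2 * card {a. a dvd n \<and> a * a < n}"
proof -
  have "0 < n" using assms by (metis mult_0 neq0_conv)
  then have fin: "finite {a. a dvd n}" by simp
  have swap: "n div a dvd n \<and> n div (n div a) = a \<and>
      (n div a * (n div a) > n \<longleftrightarrow> a * a < n) \<and> (n div a * (n div a) < n \<longleftrightarrow> a * a > n)"
    if "a dvd n" for a
  proof -
    from that obtain k where k: "n = a * k" by blast
    with \<open>0 < n\<close> have "0 < a" "0 < k" by simp_all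
    then show ?thesis by (simp add: k)
  qed
  have "bij_betw (\<lambda>a. n div a) {a. a dvd n \<and> a * a < n} {a. a dvd n \<and> a * a > n}"
    by (rule bij_betwI[where g = "\<lambda>a. n div a"]) (use swap in auto)
  then have *: "card {a. a dvd n \<and> a * a > n} = card {a. a dvd n \<and> a * a < n}"
    by (simp add: bij_betw_same_card)
  have "{a. a dvd n} = {a. a dvd n \<and> a * a < n} \<union> {a. a dvd n \<and> a * a > n}"
    using assms by (auto simp: not_less le_less)
  then have "card {a. a dvd n} = card ({a. a dvd n \<and> a * a < n} \<union> {a. a dvd n \<and> a * a > n})"
    by (rule arg_cong)
  also have "\<dots> = card {a. a dvd n \<and> a * a < n} + card {a. a dvd n \<and> a * a > n}"
    using fin by (intro card_Un_disjoint) auto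
  finally show ?thesis using * by simp
qed

theorem eight_dvd_card_overpartitions:
  assumes "odd n" and "\<nexists>s. s * s = n"
  shows "8 dvd card (overpartitions n)"
proof -
  have "0 < n" using assms(1) by (auto intro: Nat.gr0I)
  let ?L = "{a. a dvd n \<and> a * a < n}" and ?T = "two_size_data n"
  have card_T: "card ?T = card {M. is_partition M n \<and> card (set_mset M) = 2}"
    using bij_betw_two_size_data by (rule bij_betw_same_card)
  have "finite ?T"
    using bij_betw_finite[OF bij_betw_two_size_data] finite_partitions[of n] by simp
  have "even (card {x \<in> ?T. conjugate x \<noteq> x})"
    by (rule even_card_involution[where f = conjugate])
      (auto simp: conjugate_in_two_size_data conjugate_conjugate)
  then obtain k where k: "card {x \<in> ?T. conjugate x \<noteq> x} = 2 * k" by blast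
  have "?T = {x \<in> ?T. conjugate x = x} \<union> {x \<in> ?T. conjugate x \<noteq> x}" by auto
  then have "card ?T = card ({x \<in> ?T. conjugate x = x} \<union> {x \<in> ?T. conjugate x \<noteq> x})" by (rule arg_cong)
  also have "\<dots> = card ?L + 2 * k"
    using \<open>finite ?T\<close> by (subst card_Un_disjoint) (auto simp: k card_self_conjugate[OF assms(1)])
  finally have "[card (overpartitions n) = 2 * (2 * card ?L) + 4 * (card ?L + 2 * k)] (mod 8)"
    using card_overpartitions_cong[OF \<open>0 < n\<close>]
    by (simp only: card_one_size_partitions[OF \<open>0 < n\<close>] card_divisors_nonsquare[OF assms(2)]
        flip: card_T)
  moreover have "2 * (2 * card ?L) + 4 * (card ?L + 2 * k) = 8 * (card ?L + k)" by simp
  ultimately show ?thesis by (simp add: cong_dvd_iff)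
qed

section \<open>Detaching the non-overlined multiples of l\<close>

definition divisible_parts :: "nat \<Rightarrow> nat multiset \<times> nat set \<Rightarrow> nat multiset" where
  "divisible_parts l P = {#p \<in># non_overlined_parts P. l dvd p#}"

lemma Rstar_eq: "Rstar l n = card {P \<in> overpartitions n. divisible_parts l P = {#}}"
  unfolding Rstar_def divisible_parts_def filter_mset_eq_mempty_iff Ball_def ..

lemma mset_set_overlined_subset:
  "S \<subseteq> set_mset M \<longleftrightarrow> finite S \<and> mset_set S \<subseteq># M"
proof
  show "finite S \<and> mset_set S \<subseteq># M" if "S \<subseteq> set_mset M"
    using that by (metis finite_set_mset finite_subset mset_set_set_mset_msubset
        subset_imp_msubset_mset_set subset_mset.order_trans)
  show "S \<subseteq> set_mset M" if "finite S \<and> mset_set S \<subseteq># M"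
    using that set_mset_mono by fastforce
qed

lemma divisible_partsD:
  assumes "P \<in> overpartitions n" "p \<in># divisible_parts l P"
  shows "0 < p" "l dvd p"
  using assms
  by (auto simp: divisible_parts_def non_overlined_parts_def overpartitions_def
      is_partition_def dest!: in_diffD split: prod.splits)

text \<open>
  An overpartition amounts to the pair of its set \<open>S\<close> of overlined parts and its multiset \<open>K\<close> of
  non-overlined parts, which are independent of each other except for their total \<open>n\<close>.
\<close>

lemma overpartition_iff:
  "(M, S) \<in> overpartitions n \<longleftrightarrow> finite S \<and> (\<exists>K. M = mset_set S + K \<and>
    (\<forall>p \<in> S. 0 < p) \<and> (\<forall>p \<in># K. 0 < p) \<and> sum_mset (mset_set S) + sum_mset K = n)"
    (is "?lhs \<longleftrightarrow> ?rhs")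
proof
  assume ?lhs
  then have "finite S" and "mset_set S \<subseteq># M" and part: "is_partition M n"
    by (simp_all add: overpartitions_def mset_set_overlined_subset)
  then obtain K where K: "M = mset_set S + K"
    using subset_mset.le_iff_add by blast
  with \<open>finite S\<close> part show ?rhs
    by (intro conjI exI[of _ K]) (auto simp: is_partition_def)
next
  assume ?rhs
  then show ?lhs
    by (auto simp: overpartitions_def is_partition_def)
qed

lemma non_overlined_parts_compose:
  "non_overlined_parts (mset_set S + K, S) = K"
  by (simp add: non_overlined_parts_def)

text \<open>
  Removing \<open>N\<close> is a bijection from the overpartitions of \<open>n\<close> whose non-overlined multiples of \<open>l\<close> are
  exactly \<open>N\<close> onto the overpartitions counted by \<^const>\<open>Rstar\<close>. The overpartition \<open>P0\<close> witnesses
  that the fibre over \<open>N\<close> is nonempty, so that the elements of \<open>N\<close> are positive multiples of \<open>l\<close>.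
\<close>

lemma card_divisible_parts_fibre:
  assumes "P0 \<in> overpartitions n" and N: "divisible_parts l P0 = N"
  shows "card {P \<in> overpartitions n. divisible_parts l P = N} = Rstar l (n - sum_mset N)"
    and "sum_mset N \<le> n"
proof -
  have pos: "\<And>p. p \<in># N \<Longrightarrow> 0 < p" and N_div: "\<And>p. p \<in># N \<Longrightarrow> l dvd p"
    using divisible_partsD assms by blast+
  have filter_N: "{#p \<in># N. l dvd p#} = N"
    using N_div by (simp add: filter_mset_eq_conv)
  have fibreE: "\<exists>K. finite S \<and> M = mset_set S + K + N \<and> {#p \<in># K. l dvd p#} = {#} \<and>
      (\<forall>p \<in> S. 0 < p) \<and> (\<forall>p \<in># K. 0 < p) \<and> sum_mset (mset_set S) + sum_mset K + sum_mset N = n"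
    if P: "(M, S) \<in> overpartitions n" and "divisible_parts l (M, S) = N" for M S
  proof -
    obtain L where L: "finite S" "M = mset_set S + L" "\<forall>p \<in> S. 0 < p"
        "\<forall>p \<in># L. 0 < p" "sum_mset (mset_set S) + sum_mset L = n"
      using P overpartition_iff by blast
    have "{#p \<in># L. l dvd p#} = N"
      using that(2) by (simp only: L(2) divisible_parts_def non_overlined_parts_compose)
    then have "L = {#p \<in># L. \<not> l dvd p#} + N"
      by (metis add.commute multiset_partition)
    then obtain K where "L = K + N" by blast
    \<comment> \<open>\<open>N\<close> already consists of all multiples of \<open>l\<close> in \<open>L\<close>, so none is left in \<open>K\<close>.\<close>
    have "{#p \<in># K. l dvd p#} + N = N"
      using \<open>{#p \<in># L. l dvd p#} = N\<close> unfolding \<open>L = K + N\<close> filter_union_mset filter_N .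
    then have "{#p \<in># K. l dvd p#} = {#}"
      by (simp only: add_0_left add_cancel_left_left)
    with L \<open>L = K + N\<close> show ?thesis
      by (intro exI[of _ K] conjI) (simp_all add: add.assoc)
  qed
  show "sum_mset N \<le> n"
  proof -
    obtain M S where "P0 = (M, S)" by (cases P0)
    with fibreE[of M S] assms obtain K
      where "sum_mset (mset_set S) + sum_mset K + sum_mset N = n" by blast
    then show ?thesis by linarith
  qed
  have "bij_betw (\<lambda>(M, S). (M - N, S)) {P \<in> overpartitions n. divisible_parts l P = N}
     {P \<in> overpartitions (n - sum_mset N). divisible_parts l P = {#}}"
  proof (rule bij_betwI[where g = "\<lambda>(M, S). (M + N, S)"])
    show "(\<lambda>(M, S). (M - N, S)) \<in> {P \<in> overpartitions n. divisible_parts l P = N} \<rightarrow>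
        {P \<in> overpartitions (n - sum_mset N). divisible_parts l P = {#}}"
    proof
      fix P assume P: "P \<in> {P \<in> overpartitions n. divisible_parts l P = N}"
      obtain M S where P_eq: "P = (M, S)" by (cases P)
      have "(M, S) \<in> overpartitions n" "divisible_parts l (M, S) = N"
        using P P_eq by simp_all
      from fibreE[OF this] obtain K
        where K: "finite S" "M = mset_set S + K + N" "{#p \<in># K. l dvd p#} = {#}"
          "\<forall>p \<in> S. 0 < p" "\<forall>p \<in># K. 0 < p"
          "sum_mset (mset_set S) + sum_mset K + sum_mset N = n"
        by blast
      have "(mset_set S + K, S) \<in> overpartitions (n - sum_mset N)"
        unfolding overpartition_iff using K(1,4-6) by (intro conjI exI[of _ K]) auto
      moreover have "M - N = mset_set S + K" using K(2) by simp
      moreover have "divisible_parts l (mset_set S + K, S) = {#}"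
        unfolding divisible_parts_def non_overlined_parts_compose by (rule K(3))
      ultimately show "(case P of (M, S) \<Rightarrow> (M - N, S)) \<in>
          {P \<in> overpartitions (n - sum_mset N). divisible_parts l P = {#}}"
        by (simp add: P_eq)
    qed
  next
    show "(\<lambda>(M, S). (M + N, S)) \<in>
        {P \<in> overpartitions (n - sum_mset N). divisible_parts l P = {#}} \<rightarrow>
        {P \<in> overpartitions n. divisible_parts l P = N}"
    proof
      fix P assume "P \<in> {P \<in> overpartitions (n - sum_mset N). divisible_parts l P = {#}}"
      moreover obtain M S where P_eq: "P = (M, S)" by (cases P)
      ultimately have P: "(M, S) \<in> overpartitions (n - sum_mset N)" "divisible_parts l (M, S) = {#}"
        by simp_all
      obtain K where K: "finite S" "M = mset_set S + K" "\<forall>p \<in> S. 0 < p"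
          "\<forall>p \<in># K. 0 < p" "sum_mset (mset_set S) + sum_mset K = n - sum_mset N"
        using P(1) overpartition_iff by blast
      have "(mset_set S + (K + N), S) \<in> overpartitions n"
        unfolding overpartition_iff using K(1,3-5) pos \<open>sum_mset N \<le> n\<close>
        by (intro conjI exI[of _ "K + N"]) auto
      moreover have "{#p \<in># K. l dvd p#} = {#}"
        using P(2) by (simp only: K(2) divisible_parts_def non_overlined_parts_compose)
      then have "divisible_parts l (mset_set S + (K + N), S) = N"
        unfolding divisible_parts_def non_overlined_parts_compose filter_union_mset filter_N by simp
      ultimately show "(case P of (M, S) \<Rightarrow> (M + N, S)) \<in>
          {P \<in> overpartitions n. divisible_parts l P = N}"
        by (simp add: P_eq K(2) add.assoc)
    qed
  next
    show "(case (case P of (M, S) \<Rightarrow> (M - N, S)) of (M, S) \<Rightarrow> (M + N, S)) = P"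
      if "P \<in> {P \<in> overpartitions n. divisible_parts l P = N}" for P
    proof -
      obtain M S where P_eq: "P = (M, S)" by (cases P)
      have "(M, S) \<in> overpartitions n" "divisible_parts l (M, S) = N"
        using that P_eq by simp_all
      from fibreE[OF this] obtain K where "M = mset_set S + K + N" by blast
      then show ?thesis by (simp add: P_eq)
    qed
  next
    show "(case (case P of (M, S) \<Rightarrow> (M + N, S)) of (M, S) \<Rightarrow> (M - N, S)) = P" for P
      by (cases P) simp
  qed
  then show "card {P \<in> overpartitions n. divisible_parts l P = N} = Rstar l (n - sum_mset N)"
    unfolding Rstar_eq by (rule bij_betw_same_card)
qed

text \<open>
  Sorting the overpartitions of \<open>n\<close> by their non-overlined multiples of \<open>l\<close> expresses their number as
  \<open>Rstar l n\<close> plus values of \<open>Rstar l\<close> at smaller numbers of the same residue class, to which the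
  induction hypothesis applies.
\<close>

theorem dvd_Rstar_if_dvd_overpartitions:
  assumes "\<And>k. k \<le> n \<Longrightarrow> [k = n] (mod l) \<Longrightarrow> m dvd card (overpartitions k)"
  shows "m dvd Rstar l n"
  using assms
proof (induction n rule: less_induct)
  case (less n)
  let ?O = "overpartitions n"
  let ?F = "\<lambda>N. {P \<in> ?O. divisible_parts l P = N}"
  show ?case
  proof (cases "{#} \<in> divisible_parts l ` ?O")
    case False
    then have "?F {#} = {}" by (auto simp: image_iff)
    then show ?thesis by (simp only: Rstar_eq card.empty dvd_0_right)
  next
    case True
    have fin: "finite ?O" by (rule finite_overpartitions)
    have "card ?O = (\<Sum>N \<in> divisible_parts l ` ?O. card (?F N))"
      using sum.image_gen[OF fin, of "\<lambda>_. 1 :: nat" "divisible_parts l"] by simp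
    also have "\<dots> = Rstar l n + (\<Sum>N \<in> divisible_parts l ` ?O - {{#}}. card (?F N))"
      using True fin by (simp add: sum.remove[of _ "{#}"] Rstar_eq)
    finally have split: "card ?O = \<dots>" .
    have "m dvd card (?F N)" if N: "N \<in> divisible_parts l ` ?O - {{#}}" for N
    proof -
      from N obtain P0 where P0: "P0 \<in> ?O" "divisible_parts l P0 = N" and "N \<noteq> {#}" by blast
      have N_pos: "0 < p" and N_div: "l dvd p" if "p \<in># N" for p
        using divisible_partsD P0 that by blast+
      have "0 < sum_mset N"
        using \<open>N \<noteq> {#}\<close> N_pos by (auto intro!: Nat.gr0I) (metis less_irrefl multiset_nonemptyE)
      note fibre = card_divisible_parts_fibre[OF P0]
      have "l dvd sum_mset N" using N_div by (induction N) auto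
      then have cong: "[n - sum_mset N = n] (mod l)"
        using fibre(2) unfolding cong_def by (metis dvdE le_add_diff_inverse2 mod_mult_self2)
      have "m dvd Rstar l (n - sum_mset N)"
      proof (rule less.IH)
        show "n - sum_mset N < n" using \<open>0 < sum_mset N\<close> fibre(2) by simp
        show "m dvd card (overpartitions k)"
          if "k \<le> n - sum_mset N" "[k = n - sum_mset N] (mod l)" for k
          using that cong by (intro less.prems) (simp, rule cong_trans)
      qed
      then show ?thesis using fibre(1) by simp
    qed
    then have "m dvd (\<Sum>N \<in> divisible_parts l ` ?O - {{#}}. card (?F N))"
      by (rule dvd_sum)
    moreover have "m dvd card ?O" using less.prems by simp
    ultimately show ?thesis unfolding split by (simp add: dvd_add_left_iff)
  qed
qed

section \<open>The residue classes modulo 8\<close>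

lemma odd_square_mod_8: "odd s \<Longrightarrow> (s * s) mod 8 = (1 :: nat)"
proof -
  assume "odd s"
  then have "s mod 8 \<in> {1, 3, 5, 7}" by (simp; presburger)
  then show ?thesis by (subst mod_mult_eq[symmetric]) auto
qed

theorem eight_dvd_Rstar_8:
  assumes "odd n" and "n mod 8 \<noteq> 1"
  shows "8 dvd Rstar 8 n"
proof (rule dvd_Rstar_if_dvd_overpartitions)
  fix k assume "[k = n] (mod 8)"
  then have "k mod 8 = n mod 8" by (simp add: cong_def)
  then have "odd k" "k mod 8 \<noteq> 1"
    using assms by presburger+
  then show "8 dvd card (overpartitions k)"
    using odd_square_mod_8 by (intro eight_dvd_card_overpartitions) auto
qed

theorem theorem3p6:
  fixes n :: nat
  shows "[Rstar 8 (4 * n + 3) = 0] (mod 8) \<and>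
    (\<forall>\<xi> \<in> {1, 2, 3}. [Rstar 8 (8 * n + 2 * \<xi> + 1) = 0] (mod 8))"
proof (intro conjI ballI)
  show "[Rstar 8 (4 * n + 3) = 0] (mod 8)"
    unfolding cong_0_iff by (rule eight_dvd_Rstar_8; presburger)
  fix \<xi> :: nat assume "\<xi> \<in> {1, 2, 3}"
  then show "[Rstar 8 (8 * n + 2 * \<xi> + 1) = 0] (mod 8)"
    unfolding cong_0_iff by (intro eight_dvd_Rstar_8) (auto simp: mod_Suc)
qed

end
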